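(* Let $\{x^k\}$ be a sequence generated by the accelerated proximal gradient method for multiobjective optimization (described in the context) with $x^0=y^1\in\operatorname{dom}F$ and $\ell\ge L$. Let $X^\ast$ be the set of weakly Pareto optimal points of $\min_{x\in\mathbf{R}^n}F(x)$ and, for $c\in\mathbf{R}^m$, let $\mathcal{L}_F(c)=\{x\in\mathbf{R}^n : F(x)\le c\}$. Assume that for every $x\in\mathcal{L}_F(F(x^0))$ there exists $x^\ast\in X^\ast$ such that $F(x^\ast)\le F(x)$, and that $$R:=\sup_{F^\ast\in F(X^\ast\cap\mathcal{L}_F(F(x^0)))}\ \inf_{z\in F^{-1}(\{F^\ast\})}\|z-x^0\|^2<+\infty .$$ Then $$u_0(x^k)\le\frac{2\ell R}{(k+1)^2}\qquad\text{for all }k\ge1,$$ where $u_0(x):=\sup_{z\in\mathbf{R}^n}\min_{i=1,\dots,m}[F_i(x)-F_i(z)]$.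
   Context: Problem. $F=(F_1,\dots,F_m)^\top:\mathbf{R}^n\to(\mathbf{R}\cup\{+\infty\})^m$ with $F_i=f_i+g_i$, where each $f_i:\mathbf{R}^n\to\mathbf{R}$ is convex and continuously differentiable with $\nabla f_i$ Lipschitz continuous with constant $L_i>0$, and each $g_i:\mathbf{R}^n\to\mathbf{R}\cup\{+\infty\}$ is closed, proper and convex. Put $L:=\max_i L_i$ and $\operatorname{dom}F:=\{x : F_i(x)<+\infty\ \text{for all }i\}$. Vector inequalities $\le$, $<$ are componentwise; $\langle\cdot,\cdot\rangle$, $\|\cdot\|$ are Euclidean. A point $x^\ast$ is weakly Pareto optimal if there is no $x\in\mathbf{R}^n$ with $F(x)<F(x^\ast)$ (strict in every component). $F(A)$ and $F^{-1}(B)$ denote image and inverse image. Subproblem. For $x\in\operatorname{dom}F$, $y\in\mathbf{R}^n$, $\ell\ge L$, let $$\varphi^{\mathrm{acc}}_\ell(z;x,y):=\max_{i=1,\dots,m}\left[\langle\nabla f_i(y),z-y\rangle+g_i(z)+f_i(y)-F_i(x)\right]+\frac{\ell}{2}\|z-y\|^2,$$ and let $p^{\mathrm{acc}}_\ell(x,y)$ be its unique minimizer over $z\in\mathbf{R}^n$. Algorithm (accelerated proximal gradient method). Given $x^0=y^1\in\operatorname{dom}F$, $\ell\ge L$, and $t_1=1$, for $k=1,2,\dots$ set $x^k=p^{\mathrm{acc}}_\ell(x^{k-1},y^k)$, $t_{k+1}=\sqrt{t_k^2+1/4}+1/2$, $\gamma_k=(t_k-1)/t_{k+1}$, $y^{k+1}=x^k+\gamma_k(x^k-x^{k-1})$.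 The sequences are taken to be infinite (no termination test). *)

theory Defs
  imports "HOL-Analysis.Analysis"
begin

text \<open>
  Functions into \<open>\<real> \<union> {+\<infinity>}\<close> are modelled as \<^typ>\<open>ereal\<close>-valued functions; properness excludes the
  value \<open>-\<infinity>\<close>. Vectors in \<open>(\<real> \<union> {+\<infinity>})\<^sup>m\<close> are functions on the finite index type \<open>'m\<close>, so that
  \<open>\<le>\<close> is the componentwise order. The strict order \<open><\<close> on functions is not componentwise and is
  not used.
\<close>

definition closed_fun :: "('a::topological_space \<Rightarrow> ereal) \<Rightarrow> bool" where
  "closed_fun h \<longleftrightarrow> closed {(x, r::real). h x \<le> ereal r}"

definition proper_fun :: "('a \<Rightarrow> ereal) \<Rightarrow> bool" where
  "proper_fun h \<longleftrightarrow> (\<forall>x. h x \<noteq> -\<infinity>) \<and> (\<exists>x. h x < \<infinity>)"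

text \<open>The analogue of \<^const>\<open>convex_on\<close> on the whole space; meant for functions without value \<open>-\<infinity>\<close>.\<close>

definition convex_fun :: "('a::real_vector \<Rightarrow> ereal) \<Rightarrow> bool" where
  "convex_fun h \<longleftrightarrow> (\<forall>x y. \<forall>u\<ge>0. \<forall>v\<ge>0. u + v = 1 \<longrightarrow>
      h (u *\<^sub>R x + v *\<^sub>R y) \<le> ereal u * h x + ereal v * h y)"

definition composite_obj ::
  "('m \<Rightarrow> 'a \<Rightarrow> real) \<Rightarrow> ('m \<Rightarrow> 'a \<Rightarrow> ereal) \<Rightarrow> 'a \<Rightarrow> 'm \<Rightarrow> ereal" where
  "composite_obj f g x i = ereal (f i x) + g i x"

definition effective_dom :: "('a \<Rightarrow> 'm \<Rightarrow> ereal) \<Rightarrow> 'a set" where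
  "effective_dom F = {x. \<forall>i. F x i < \<infinity>}"

definition level_set :: "('a \<Rightarrow> 'm \<Rightarrow> ereal) \<Rightarrow> ('m \<Rightarrow> ereal) \<Rightarrow> 'a set" where
  "level_set F c = {x. F x \<le> c}"

definition weakly_pareto_set :: "('a \<Rightarrow> 'm \<Rightarrow> ereal) \<Rightarrow> 'a set" where
  "weakly_pareto_set F = {xs. \<not> (\<exists>x. \<forall>i. F x i < F xs i)}"

text \<open>
  In \<^typ>\<open>ereal\<close>, \<open>\<infinity> - \<infinity> = \<infinity>\<close>; this does not occur for \<open>x\<close> in the effective domain (in both
  \<open>merit\<close> and \<open>phi_acc\<close>), where every \<open>F x i\<close> is finite.
\<close>

definition merit :: "('a \<Rightarrow> 'm::finite \<Rightarrow> ereal) \<Rightarrow> 'a \<Rightarrow> ereal" where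
  "merit F x = (SUP z. MIN i. F x i - F z i)"

definition phi_acc ::
  "('m::finite \<Rightarrow> 'a::real_inner \<Rightarrow> real) \<Rightarrow> ('m \<Rightarrow> 'a \<Rightarrow> 'a) \<Rightarrow> ('m \<Rightarrow> 'a \<Rightarrow> ereal) \<Rightarrow>
    real \<Rightarrow> 'a \<Rightarrow> 'a \<Rightarrow> 'a \<Rightarrow> ereal" where
  "phi_acc f gradf g l x y z =
     (MAX i. ereal (gradf i y \<bullet> (z - y)) + g i z + ereal (f i y) - composite_obj f g x i)
     + ereal (l / 2 * (norm (z - y))\<^sup>2)"

text \<open>
  For \<open>l > 0\<close> and \<open>x\<close> in the effective domain, \<open>phi_acc\<close> is closed, proper and strongly convex in
  \<open>z\<close>, so the choice made by \<^const>\<open>arg_min\<close> is the unique minimizer.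
\<close>

definition p_acc ::
  "('m::finite \<Rightarrow> 'a::real_inner \<Rightarrow> real) \<Rightarrow> ('m \<Rightarrow> 'a \<Rightarrow> 'a) \<Rightarrow> ('m \<Rightarrow> 'a \<Rightarrow> ereal) \<Rightarrow>
    real \<Rightarrow> 'a \<Rightarrow> 'a \<Rightarrow> 'a" where
  "p_acc f gradf g l x y = (ARG_MIN (phi_acc f gradf g l x y) z. True)"

text \<open>The values \<open>y 0\<close>, \<open>t 0\<close> and \<open>\<gamma> 0\<close> play no role.\<close>

definition accelerated_prox_grad ::
  "('m::finite \<Rightarrow> 'a::real_inner \<Rightarrow> real) \<Rightarrow> ('m \<Rightarrow> 'a \<Rightarrow> 'a) \<Rightarrow> ('m \<Rightarrow> 'a \<Rightarrow> ereal) \<Rightarrow> real \<Rightarrow>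
    (nat \<Rightarrow> 'a) \<Rightarrow> (nat \<Rightarrow> 'a) \<Rightarrow> (nat \<Rightarrow> real) \<Rightarrow> (nat \<Rightarrow> real) \<Rightarrow> bool" where
  "accelerated_prox_grad f gradf g l x y t \<gamma> \<longleftrightarrow>
     x 0 = y 1 \<and> x 0 \<in> effective_dom (composite_obj f g) \<and> t 1 = 1 \<and>
     (\<forall>k\<ge>1. x k = p_acc f gradf g l (x (k - 1)) (y k) \<and>
            t (k + 1) = sqrt ((t k)\<^sup>2 + 1 / 4) + 1 / 2 \<and>
            \<gamma> k = (t k - 1) / t (k + 1) \<and>
            y (k + 1) = x k + \<gamma> k *\<^sub>R (x k - x (k - 1)))"

definition sup_inf_sq_dist ::
  "('a::real_normed_vector \<Rightarrow> 'm \<Rightarrow> ereal) \<Rightarrow> 'a \<Rightarrow> ereal" where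
  "sup_inf_sq_dist F x0 =
     (SUP Fs \<in> F ` (weakly_pareto_set F \<inter> level_set F (F x0)).
        INF z \<in> F -` {Fs}. ereal ((norm (z - x0))\<^sup>2))"

end

theory Submission
  imports Defs
begin

text \<open>
  Fix a step \<open>p = p_acc f gradf g l x y\<close>. The function it minimises is strongly convex with
  modulus \<open>l\<close>, so it grows at least like \<open>l / 2 * (norm (z - p))\<^sup>2\<close> around \<open>p\<close>. Sandwiching the
  linearised objectives between the true ones (by convexity from above, by the Lipschitz
  gradients from below) gives
  \<open>(MAX i. F p i - F x i) + l / 2 * (norm (z - p))\<^sup>2 \<le> (MAX i. F z i - F x i) + l / 2 * (norm (z - y))\<^sup>2\<close>,
  the lemma \<open>p_acc_three_point\<close>. Everything else is drawn from this inequality.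

  Put \<open>\<sigma> k z = (MIN i. F (x k) i - F z i)\<close>. Taking \<open>z = x\<close> bounds the decrease from \<open>\<sigma> k z\<close> to
  \<open>\<sigma> (k + 1) z\<close> from below, uniformly in the components (\<open>gap_decrease\<close>); a general \<open>z\<close> bounds
  \<open>\<sigma> (k + 1) z\<close> from above (\<open>gap_le\<close>). Weighted by \<open>s * (s - 1)\<close> and \<open>s\<close>, where
  \<open>s = t (k + 1)\<close>, and added, they show that
  \<open>(t k)\<^sup>2 * \<sigma> k z + l / 2 * (norm (t k *\<^sub>R x k - (t k - 1) *\<^sub>R x (k - 1) - z))\<^sup>2\<close>
  does not increase: the recursion for \<open>t\<close> says \<open>s * (s - 1) = (t k)\<^sup>2\<close>, and the extrapolation
  rule makes the squared norms telescope. As \<open>t k \<ge> (k + 1) / 2\<close>, this yields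
  \<open>\<sigma> k z \<le> 2 * l * (norm (z - x 0))\<^sup>2 / (k + 1)\<^sup>2\<close> for every \<open>z\<close> where \<open>F\<close> is finite (\<open>gap_rate\<close>).

  To pass to the supremum over \<open>z\<close>, only points with \<open>\<sigma> k z > 0\<close> matter. These satisfy
  \<open>F z \<le> F (x k) \<le> F (x 0)\<close>, the last step being an energy estimate (\<open>energy_le_start\<close>), so the
  hypothesis provides a weakly Pareto optimal point that dominates \<open>z\<close>. Since \<open>\<sigma> k\<close> sees a
  point only through its objective values, the distance may be taken from the whole fibre of
  that point, and \<open>R\<close> bounds its infimum.
\<close>

section \<open>Minimisers of strongly convex functions\<close>

text \<open>
  Closed sublevel sets are exactly what compactness can use: if no point were minimal, the open
  sets of points with value above \<open>\<psi> c\<close>, for \<open>c\<close> in the set, would form a cover, and in a finite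
  subcover the centre with the least value is left out.
\<close>

lemma closed_sublevels_attain_min:
  fixes \<psi> :: "'a::t2_space \<Rightarrow> real"
  assumes "compact C" and "C \<inter> D \<noteq> {}"
    and closed: "\<And>a. closed {z \<in> D. \<psi> z \<le> a}"
  obtains p where "p \<in> C \<inter> D" and "\<And>z. z \<in> C \<inter> D \<Longrightarrow> \<psi> p \<le> \<psi> z"
proof -
  have "\<exists>p \<in> C \<inter> D. \<forall>z \<in> C \<inter> D. \<psi> p \<le> \<psi> z"
  proof (rule ccontr)
    assume neg: "\<not> ?thesis"
    obtain q where q: "q \<in> C \<inter> D" using assms(2) by blast
    define U where "U c = - {z \<in> D. \<psi> z \<le> \<psi> c}" for c
    have "C \<inter> {z \<in> D. \<psi> z \<le> \<psi> q} \<subseteq> (\<Union>c \<in> C \<inter> D. U c)"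
    proof
      fix z assume z: "z \<in> C \<inter> {z \<in> D. \<psi> z \<le> \<psi> q}"
      then obtain c where "c \<in> C \<inter> D" "\<not> \<psi> z \<le> \<psi> c"
        using neg by blast
      then show "z \<in> (\<Union>c \<in> C \<inter> D. U c)" by (auto simp: U_def)
    qed
    moreover have "compact (C \<inter> {z \<in> D. \<psi> z \<le> \<psi> q})"
      using assms(1) closed by (rule compact_Int_closed)
    moreover have "open (U c)" for c
      using closed by (simp add: U_def open_Compl)
    ultimately obtain T where T: "T \<subseteq> C \<inter> D" "finite T"
      "C \<inter> {z \<in> D. \<psi> z \<le> \<psi> q} \<subseteq> (\<Union>c \<in> T. U c)"
      by (metis (no_types, lifting) compactE_image)
    \<comment> \<open>A point of least value among the finitely many centres and \<open>q\<close> is not covered.\<close>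
    have "finite (insert q T)" using T(2) by simp
    then obtain p where p: "p \<in> insert q T" "\<And>c. c \<in> insert q T \<Longrightarrow> \<psi> p \<le> \<psi> c"
      using finite_has_minimal[of "\<psi> ` insert q T"]
      by (metis (no_types, lifting) arg_min_if_finite(1) arg_min_least empty_iff insertI1)
    have "p \<in> C \<inter> {z \<in> D. \<psi> z \<le> \<psi> q}" using p q T(1) by auto
    then obtain c where "c \<in> T" "p \<in> U c" using T(3) by blast
    then show False using p(2)[of c] \<open>p \<in> C \<inter> {z \<in> D. \<psi> z \<le> \<psi> q}\<close> by (auto simp: U_def)
  qed
  then show ?thesis using that by blast
qed

lemma strongly_convex_onD:
  fixes \<psi> :: "'a::real_inner \<Rightarrow> real"
  assumes "convex_on D (\<lambda>z. \<psi> z - c / 2 * (norm z)\<^sup>2)"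
    and "z \<in> D" and "w \<in> D" and "0 \<le> u" and "u \<le> 1"
  shows "\<psi> ((1 - u) *\<^sub>R z + u *\<^sub>R w)
    \<le> (1 - u) * \<psi> z + u * \<psi> w - c / 2 * (u * (1 - u) * (norm (w - z))\<^sup>2)"
proof -
  have le: "\<psi> ((1 - u) *\<^sub>R z + u *\<^sub>R w) - c / 2 * (norm ((1 - u) *\<^sub>R z + u *\<^sub>R w))\<^sup>2
    \<le> (1 - u) * (\<psi> z - c / 2 * (norm z)\<^sup>2) + u * (\<psi> w - c / 2 * (norm w)\<^sup>2)"
    using convex_onD[OF assms(1), of u z w] assms(2-) by simp
  have eq: "(norm ((1 - u) *\<^sub>R z + u *\<^sub>R w))\<^sup>2
    = (1 - u) * (norm z)\<^sup>2 + u * (norm w)\<^sup>2 - u * (1 - u) * (norm (w - z))\<^sup>2"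
    unfolding power2_norm_eq_inner
    by (simp add: inner_simps inner_commute algebra_simps power2_eq_square)
  show ?thesis using le unfolding eq by (simp add: field_simps)
qed

text \<open>
  Strong convexity turns a lower bound on the unit ball around a point \<open>z0\<close> into quadratic growth
  along every ray from \<open>z0\<close>, so that only a bounded part of the domain competes for the
  minimum.
\<close>

lemma strongly_convex_attains_min:
  fixes \<psi> :: "'a::euclidean_space \<Rightarrow> real"
  assumes convex: "convex_on D (\<lambda>z. \<psi> z - c / 2 * (norm z)\<^sup>2)"
    and "c > 0" and "D \<noteq> {}"
    and closed: "\<And>a. closed {z \<in> D. \<psi> z \<le> a}"
  obtains p where "p \<in> D" and "\<And>z. z \<in> D \<Longrightarrow> \<psi> p \<le> \<psi> z"
proof -
  obtain z0 where z0: "z0 \<in> D" using assms(3) by blast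
  have "z0 \<in> cball z0 1 \<inter> D" using z0 by simp
  then have "cball z0 1 \<inter> D \<noteq> {}" by blast
  from closed_sublevels_attain_min[OF compact_cball this closed] obtain q where
    q: "q \<in> cball z0 1 \<inter> D" "\<And>z. z \<in> cball z0 1 \<inter> D \<Longrightarrow> \<psi> q \<le> \<psi> z" by blast
  define d where "d = \<psi> z0 - \<psi> q"
  have d: "d \<ge> 0" using q(2)[of z0] z0 by (simp add: d_def)
  \<comment> \<open>At distance \<open>r\<close> from \<open>z0\<close> the lower bound below is \<open>\<psi> z0 + r * (c / 2 * (r - 1) - d)\<close>, and
    \<open>K\<close> is the radius at which its bracket vanishes.\<close>
  define K where "K = 1 + 2 * d / c"
  have K: "K \<ge> 1" using d \<open>c > 0\<close> by (simp add: K_def)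
  have "z0 \<in> cball z0 K \<inter> D" using z0 K by simp
  then have "cball z0 K \<inter> D \<noteq> {}" by blast
  from closed_sublevels_attain_min[OF compact_cball this closed] obtain p where
    p: "p \<in> cball z0 K \<inter> D" "\<And>z. z \<in> cball z0 K \<inter> D \<Longrightarrow> \<psi> p \<le> \<psi> z" by blast
  have "\<psi> p \<le> \<psi> z" if z: "z \<in> D" for z
  proof (cases "norm (z - z0) \<le> K")
    case True
    then show ?thesis using p(2)[of z] z by (simp add: dist_norm norm_minus_commute)
  next
    case False
    define r where "r = norm (z - z0)"
    have r: "r > K" "r > 1" using False K by (auto simp: r_def)
    \<comment> \<open>The point at distance \<open>1\<close> from \<open>z0\<close> in the direction of \<open>z\<close>.\<close>
    define w where "w = (1 - 1 / r) *\<^sub>R z0 + (1 / r) *\<^sub>R z"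
    have "w - z0 = (1 / r) *\<^sub>R (z - z0)" by (simp add: w_def algebra_simps)
    moreover have "z \<noteq> z0" using r(2) by (auto simp: r_def)
    ultimately have "norm (w - z0) = 1" by (simp add: r_def)
    moreover have "w \<in> D"
      unfolding w_def using convex_on_imp_convex[OF convex] z0 z r
      by (intro convexD) auto
    ultimately have "\<psi> q \<le> \<psi> w"
      by (intro q(2)) (simp add: dist_norm norm_minus_commute)
    also have "\<psi> w \<le> (1 - 1 / r) * \<psi> z0 + 1 / r * \<psi> z - c / 2 * (1 / r * (1 - 1 / r) * r\<^sup>2)"
      using strongly_convex_onD[OF convex z0 z, of "1 / r", folded w_def r_def] r by simp
    finally have "r * \<psi> q \<le> r * ((1 - 1 / r) * \<psi> z0 + 1 / r * \<psi> z - c / 2 * (1 / r * (1 - 1 / r) * r\<^sup>2))"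
      using r by (intro mult_left_mono) auto
    also have "\<dots> = (r - 1) * \<psi> z0 + \<psi> z - c / 2 * (r * (r - 1))"
      using r by (simp add: field_simps power2_eq_square)
    finally have "\<psi> z \<ge> \<psi> z0 + r * (c / 2 * (r - 1) - d)"
      by (simp add: d_def algebra_simps)
    moreover have "c / 2 * (r - 1) \<ge> d"
      using r(1) \<open>c > 0\<close> by (simp add: K_def field_simps)
    ultimately have "\<psi> z \<ge> \<psi> z0" using r
      by (smt (verit) mult_nonneg_nonneg)
    moreover have "\<psi> p \<le> \<psi> z0" using p(2)[of z0] z0 K by simp
    ultimately show ?thesis by simp
  qed
  then show ?thesis using p(1) that by blast
qed

text \<open>
  This replaces the optimality conditions of the minimiser, so that neither subgradients nor
  multipliers for the maximum enter the analysis. Minimality of \<open>p\<close> is compared with a point at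
  fraction \<open>u\<close> of the way to \<open>z\<close>; after division by \<open>u\<close> the claim is the limit \<open>u \<rightarrow> 0\<close>.
\<close>

lemma strongly_convex_growth_at_min:
  fixes \<psi> :: "'a::real_inner \<Rightarrow> real"
  assumes convex: "convex_on D (\<lambda>z. \<psi> z - c / 2 * (norm z)\<^sup>2)"
    and p: "p \<in> D" "\<And>z. z \<in> D \<Longrightarrow> \<psi> p \<le> \<psi> z" and z: "z \<in> D"
  shows "\<psi> p + c / 2 * (norm (z - p))\<^sup>2 \<le> \<psi> z"
proof -
  let ?N = "c / 2 * (norm (z - p))\<^sup>2"
  have bound: "\<psi> p + (1 - u) * ?N \<le> \<psi> z" if u: "0 < u" "u < 1" for u
  proof -
    have "(1 - u) *\<^sub>R p + u *\<^sub>R z \<in> D"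
      using convex_on_imp_convex[OF convex] p(1) z u by (intro convexD) auto
    then have "\<psi> p \<le> (1 - u) * \<psi> p + u * \<psi> z - c / 2 * (u * (1 - u) * (norm (z - p))\<^sup>2)"
      using p(2) strongly_convex_onD[OF convex p(1) z, of u] u by fastforce
    then have "u * (\<psi> p + (1 - u) * ?N) \<le> u * \<psi> z" by (simp add: field_simps)
    then show ?thesis using u by simp
  qed
  have "((\<lambda>u. \<psi> p + (1 - u) * ?N) \<longlongrightarrow> \<psi> p + (1 - 0) * ?N) (at_right (0::real))"
    by (intro tendsto_intros)
  moreover have "eventually (\<lambda>u. \<psi> p + (1 - u) * ?N \<le> \<psi> z) (at_right (0::real))"
    using eventually_at_right_real[OF zero_less_one]
    by (rule eventually_mono) (use bound in auto)
  ultimately have "\<psi> p + (1 - 0) * ?N \<le> \<psi> z"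
    by (rule tendsto_upperbound) simp
  then show ?thesis by simp
qed

lemma convex_on_Max:
  fixes a :: "'m::finite \<Rightarrow> 'a::real_vector \<Rightarrow> real"
  assumes "\<And>i. convex_on D (a i)"
  shows "convex_on D (\<lambda>z. MAX i. a i z)"
proof (rule convex_onI)
  show "convex D" using assms by (rule convex_on_imp_convex)
next
  fix u :: real and z w assume u: "0 < u" "u < 1" and zw: "z \<in> D" "w \<in> D"
  have "a i ((1 - u) *\<^sub>R z + u *\<^sub>R w) \<le> (1 - u) * (MAX i. a i z) + u * (MAX i. a i w)" for i
  proof -
    have "a i ((1 - u) *\<^sub>R z + u *\<^sub>R w) \<le> (1 - u) * a i z + u * a i w"
      using convex_onD[OF assms, of u z w i] u zw by simp
    also have "\<dots> \<le> (1 - u) * (MAX i. a i z) + u * (MAX i. a i w)"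
      using u by (intro add_mono mult_left_mono) auto
    finally show ?thesis .
  qed
  then show "(MAX i. a i ((1 - u) *\<^sub>R z + u *\<^sub>R w)) \<le> (1 - u) * (MAX i. a i z) + u * (MAX i. a i w)"
    by auto
qed

section \<open>First-order bounds on the smooth part\<close>

lemma GDERIV_along_line:
  assumes "\<And>x. GDERIV f x :> f' x"
  shows "((\<lambda>s. f (y + s *\<^sub>R d)) has_real_derivative f' (y + s *\<^sub>R d) \<bullet> d) (at s)"
proof -
  have "(f has_derivative (\<lambda>h. h \<bullet> f' (y + s *\<^sub>R d))) (at (y + s *\<^sub>R d))"
    using assms by (simp add: gderiv_def)
  moreover have "((\<lambda>s. y + s *\<^sub>R d) has_derivative (\<lambda>h. h *\<^sub>R d)) (at s)"
    by (auto intro!: derivative_eq_intros)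
  ultimately have "((\<lambda>s. f (y + s *\<^sub>R d)) has_derivative (\<lambda>h. (h *\<^sub>R d) \<bullet> f' (y + s *\<^sub>R d))) (at s)"
    using has_derivative_compose by blast
  moreover have "(\<lambda>h. (h *\<^sub>R d) \<bullet> f' (y + s *\<^sub>R d)) = (*) (f' (y + s *\<^sub>R d) \<bullet> d)"
    by (simp add: fun_eq_iff inner_commute mult.commute)
  ultimately show ?thesis by (simp add: has_field_derivative_def)
qed

lemma convex_above_gradient:
  assumes convex: "convex_on UNIV f" and deriv: "\<And>x. GDERIV f x :> f' x"
  shows "f y + f' y \<bullet> (z - y) \<le> f z"
proof -
  have "convex_on UNIV (\<lambda>s::real. f (y + s *\<^sub>R (z - y)))"
  proof (rule convex_onI)
    fix u a b :: real assume u: "0 < u" "u < 1"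
    have "y + ((1 - u) * a + u * b) *\<^sub>R (z - y)
      = (1 - u) *\<^sub>R (y + a *\<^sub>R (z - y)) + u *\<^sub>R (y + b *\<^sub>R (z - y))"
      by (simp add: algebra_simps)
    then show "f (y + ((1 - u) *\<^sub>R a + u *\<^sub>R b) *\<^sub>R (z - y))
      \<le> (1 - u) * f (y + a *\<^sub>R (z - y)) + u * f (y + b *\<^sub>R (z - y))"
      using convex_onD[OF convex, of u "y + a *\<^sub>R (z - y)" "y + b *\<^sub>R (z - y)"] u by simp
  qed simp
  moreover have "((\<lambda>s. f (y + s *\<^sub>R (z - y))) has_real_derivative f' y \<bullet> (z - y)) (at 0)"
    using GDERIV_along_line[OF deriv, of y "z - y" 0] by simp
  ultimately have "f (y + 1 *\<^sub>R (z - y)) - f (y + 0 *\<^sub>R (z - y)) \<ge> f' y \<bullet> (z - y) * (1 - 0)"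
    by (intro convex_on_imp_above_tangent[where A = UNIV]) auto
  then show ?thesis by simp
qed

text \<open>
  Along the segment from \<open>y\<close> to \<open>z\<close>, subtracting the right-hand side leaves a function of one
  variable whose derivative is nonpositive by the Lipschitz condition.
\<close>

lemma lipschitz_gradient_upper_bound:
  assumes deriv: "\<And>x. GDERIV f x :> f' x" and lip: "c-lipschitz_on UNIV f'"
  shows "f z \<le> f y + f' y \<bullet> (z - y) + c / 2 * (norm (z - y))\<^sup>2"
proof -
  define d where "d = z - y"
  define h where "h s = f (y + s *\<^sub>R d) - s * (f' y \<bullet> d) - c / 2 * (norm d)\<^sup>2 * s\<^sup>2" for s
  have "\<exists>v. (h has_real_derivative v) (at s) \<and> v \<le> 0" if s: "0 \<le> s" "s \<le> 1" for s
  proof (intro exI conjI)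
    let ?v = "f' (y + s *\<^sub>R d) \<bullet> d - f' y \<bullet> d - c * (norm d)\<^sup>2 * s"
    show "(h has_real_derivative ?v) (at s)"
      unfolding h_def
      by (rule derivative_eq_intros GDERIV_along_line[OF deriv] refl | simp)+
    have "(f' (y + s *\<^sub>R d) - f' y) \<bullet> d \<le> norm (f' (y + s *\<^sub>R d) - f' y) * norm d"
      by (rule norm_cauchy_schwarz)
    also have "\<dots> \<le> (c * norm (s *\<^sub>R d)) * norm d"
      using lipschitz_onD[OF lip, of "y + s *\<^sub>R d" y]
      by (intro mult_right_mono) (auto simp: dist_norm)
    finally show "?v \<le> 0" using s by (simp add: inner_diff_left power2_eq_square algebra_simps)
  qed
  then have "h 1 \<le> h 0"
    by (intro DERIV_nonpos_imp_nonincreasing[of 0 1 h]) auto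
  then show ?thesis by (simp add: h_def d_def)
qed

section \<open>The proximal subproblem\<close>

locale composite_problem =
  fixes f :: "'m::finite \<Rightarrow> 'a::euclidean_space \<Rightarrow> real"
    and gradf :: "'m \<Rightarrow> 'a \<Rightarrow> 'a"
    and g :: "'m \<Rightarrow> 'a \<Rightarrow> ereal"
    and l :: real
  assumes f_convex: "convex_on UNIV (f i)"
    and f_gradient: "GDERIV (f i) z :> gradf i z"
    and gradf_lipschitz: "l-lipschitz_on UNIV (gradf i)"
    and l_pos: "l > 0"
    and g_closed: "closed_fun (g i)"
    and g_proper: "proper_fun (g i)"
    and g_convex: "convex_fun (g i)"
begin

abbreviation D where "D \<equiv> effective_dom (composite_obj f g)"

text \<open>
  All estimates take place on \<open>D\<close>, where every objective is finite, so that real arithmetic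
  applies to \<open>G\<close> and \<open>Fr\<close>. Outside \<open>D\<close> an infinite value of \<open>g\<close> is read as \<open>0\<close>.
\<close>

definition G where "G i z = real_of_ereal (g i z)"
definition Fr where "Fr i z = f i z + G i z"

lemma mem_dom_iff: "z \<in> D \<longleftrightarrow> (\<forall>i. g i z < \<infinity>)"
  by (simp add: effective_dom_def composite_obj_def)

lemma g_eq: "z \<in> D \<Longrightarrow> g i z = ereal (G i z)"
  using g_proper[of i] by (auto simp: mem_dom_iff G_def proper_fun_def ereal_real)

lemma composite_obj_eq: "z \<in> D \<Longrightarrow> composite_obj f g z i = ereal (Fr i z)"
  by (simp add: composite_obj_def g_eq Fr_def)

lemma convex_dom: "convex D"
proof (rule convexI)
  fix z w :: 'a and u v :: real
  assume zw: "z \<in> D" "w \<in> D" and uv: "0 \<le> u" "0 \<le> v" "u + v = 1"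
  have "g i (u *\<^sub>R z + v *\<^sub>R w) < \<infinity>" for i
  proof -
    have "g i (u *\<^sub>R z + v *\<^sub>R w) \<le> ereal u * g i z + ereal v * g i w"
      using g_convex[of i] uv by (simp add: convex_fun_def)
    also have "\<dots> < \<infinity>" using zw by (simp add: g_eq)
    finally show ?thesis .
  qed
  then show "u *\<^sub>R z + v *\<^sub>R w \<in> D" by (simp add: mem_dom_iff)
qed

lemma convex_on_G: "convex_on D (G i)"
proof (rule convex_onI[OF _ convex_dom])
  fix u :: real and z w assume u: "0 < u" "u < 1" and zw: "z \<in> D" "w \<in> D"
  have dom: "(1 - u) *\<^sub>R z + u *\<^sub>R w \<in> D"
    using convex_dom zw u by (intro convexD) auto
  have "g i ((1 - u) *\<^sub>R z + u *\<^sub>R w) \<le> ereal (1 - u) * g i z + ereal u * g i w"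
    using g_convex[of i] u by (simp add: convex_fun_def)
  then show "G i ((1 - u) *\<^sub>R z + u *\<^sub>R w) \<le> (1 - u) * G i z + u * G i w"
    using zw dom by (simp add: g_eq)
qed

text \<open>
  The set is the preimage of the closed epigraph of \<open>g i\<close> under the graph map of \<open>h\<close>.
\<close>

lemma closed_g_le_continuous:
  assumes "continuous_on UNIV h"
  shows "closed {z. g i z \<le> ereal (h z)}"
proof -
  have "closed ((\<lambda>z. (z, h z)) -` {(z, r). g i z \<le> ereal r})"
    using g_closed[of i] assms
    by (intro closed_vimage continuous_on_Pair continuous_on_id) (simp_all add: closed_fun_def)
  then show ?thesis by (simp add: vimage_def)
qed

text \<open>
  Only the smooth part of the objective is linearised at \<open>y\<close>. Up to the constant \<open>Fr i x\<close> this is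
  the entry for \<open>i\<close> in the maximum that defines the subproblem.
\<close>

definition model where "model i y z = gradf i y \<bullet> (z - y) + G i z + f i y"

lemma model_le_Fr: "model i y z \<le> Fr i z"
  using convex_above_gradient[OF f_convex f_gradient, of i y z] by (simp add: model_def Fr_def)

lemma Fr_le_model: "Fr i z \<le> model i y z + l / 2 * (norm (z - y))\<^sup>2"
  using lipschitz_gradient_upper_bound[OF f_gradient gradf_lipschitz, of i z y]
  by (simp add: model_def Fr_def)

definition subproblem where
  "subproblem x y z = (MAX i. model i y z - Fr i x) + l / 2 * (norm (z - y))\<^sup>2"

lemma phi_acc_eq_subproblem:
  assumes "x \<in> D" and "z \<in> D"
  shows "phi_acc f gradf g l x y z = ereal (subproblem x y z)"
proof -
  have "(MAX i. ereal (gradf i y \<bullet> (z - y)) + g i z + ereal (f i y) - composite_obj f g x i)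
    = (MAX i. ereal (model i y z - Fr i x))"
    using assms by (simp add: g_eq composite_obj_eq model_def)
  also have "\<dots> = ereal (MAX i. model i y z - Fr i x)"
    using mono_Max_commute[of ereal "range (\<lambda>i. model i y z - Fr i x)"]
    by (simp add: mono_def image_comp comp_def)
  finally show ?thesis by (simp add: phi_acc_def subproblem_def)
qed

lemma phi_acc_outside_dom:
  assumes "x \<in> D" and "z \<notin> D"
  shows "phi_acc f gradf g l x y z = \<infinity>"
proof -
  obtain i where "g i z = \<infinity>" using assms(2) by (auto simp: mem_dom_iff)
  then have "\<infinity> = ereal (gradf i y \<bullet> (z - y)) + g i z + ereal (f i y) - composite_obj f g x i"
    using assms(1) by (simp add: composite_obj_eq)
  also have "\<dots> \<le> (MAX i. ereal (gradf i y \<bullet> (z - y)) + g i z + ereal (f i y) - composite_obj f g x i)"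
    by (intro Max_ge) auto
  finally show ?thesis by (simp add: phi_acc_def)
qed

lemma subproblem_strongly_convex:
  "convex_on D (\<lambda>z. subproblem x y z - l / 2 * (norm z)\<^sup>2)"
proof -
  have "convex_on D (\<lambda>z. model i y z - Fr i x)" for i
  proof (rule convex_onI[OF _ convex_dom])
    fix u :: real and z w assume u: "0 < u" "u < 1" and zw: "z \<in> D" "w \<in> D"
    have "G i ((1 - u) *\<^sub>R z + u *\<^sub>R w) \<le> (1 - u) * G i z + u * G i w"
      using convex_onD[OF convex_on_G, of u z w i] u zw by simp
    then show "model i y ((1 - u) *\<^sub>R z + u *\<^sub>R w) - Fr i x
      \<le> (1 - u) * (model i y z - Fr i x) + u * (model i y w - Fr i x)"
      by (simp add: model_def inner_simps algebra_simps)
  qed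
  then have max: "convex_on D (\<lambda>z. MAX i. model i y z - Fr i x)" by (rule convex_on_Max)
  \<comment> \<open>The quadratic terms cancel and leave an affine function.\<close>
  have quad: "l / 2 * (norm (z - y))\<^sup>2 - l / 2 * (norm z)\<^sup>2 = l / 2 * (norm y)\<^sup>2 - l * (y \<bullet> z)" for z
    unfolding power2_norm_eq_inner by (simp add: inner_simps inner_commute field_simps)
  have "convex_on D (\<lambda>z. l / 2 * (norm y)\<^sup>2 - l * (y \<bullet> z))"
    by (rule convex_onI[OF _ convex_dom]) (simp add: inner_simps field_simps)
  moreover have "subproblem x y z - l / 2 * (norm z)\<^sup>2
    = (MAX i. model i y z - Fr i x) + (l / 2 * (norm y)\<^sup>2 - l * (y \<bullet> z))" for z
    unfolding subproblem_def using quad[of z] by linarith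
  ultimately show ?thesis using convex_on_add[OF max] by simp
qed

text \<open>
  A bound on a maximum is a bound on each entry, and a bound on one entry says that \<open>g i\<close> lies below
  a continuous function. Finiteness of \<open>g i\<close>, that is membership in \<open>D\<close>, comes with it.
\<close>

lemma closed_sublevel_subproblem: "closed {z \<in> D. subproblem x y z \<le> a}"
proof -
  define h where
    "h i z = a - l / 2 * (norm (z - y))\<^sup>2 - gradf i y \<bullet> (z - y) - f i y + Fr i x" for i z
  have "{z \<in> D. subproblem x y z \<le> a} = (\<Inter>i. {z. g i z \<le> ereal (h i z)})"
  proof (intro equalityI subsetI)
    fix z assume z: "z \<in> {z \<in> D. subproblem x y z \<le> a}"
    have "model i y z - Fr i x \<le> a - l / 2 * (norm (z - y))\<^sup>2" for i
    proof -
      have "model i y z - Fr i x \<le> (MAX i. model i y z - Fr i x)" by simp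
      moreover have "subproblem x y z \<le> a" using z by simp
      ultimately show ?thesis unfolding subproblem_def by linarith
    qed
    then have "G i z \<le> h i z" for i
      by (simp add: model_def h_def algebra_simps)
    then show "z \<in> (\<Inter>i. {z. g i z \<le> ereal (h i z)})" using z by (simp add: g_eq)
  next
    fix z assume z: "z \<in> (\<Inter>i. {z. g i z \<le> ereal (h i z)})"
    have "g i z < \<infinity>" for i
    proof -
      have "g i z \<le> ereal (h i z)" using z by blast
      then show ?thesis using le_less_trans by fastforce
    qed
    then have "z \<in> D" by (simp add: mem_dom_iff)
    moreover have "model i y z - Fr i x \<le> a - l / 2 * (norm (z - y))\<^sup>2" for i
      using z \<open>z \<in> D\<close> by (simp add: g_eq model_def h_def algebra_simps)
    then have "(MAX i. model i y z - Fr i x) \<le> a - l / 2 * (norm (z - y))\<^sup>2" by simp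
    then have "subproblem x y z \<le> a" unfolding subproblem_def by linarith
    ultimately show "z \<in> {z \<in> D. subproblem x y z \<le> a}" by simp
  qed
  also have "closed \<dots>"
    unfolding h_def by (intro closed_INT ballI closed_g_le_continuous continuous_intros)
  finally show ?thesis .
qed

lemma p_acc_minimises:
  assumes "x \<in> D"
  shows "p_acc f gradf g l x y \<in> D"
    and "z \<in> D \<Longrightarrow> subproblem x y (p_acc f gradf g l x y) \<le> subproblem x y z"
proof -
  let ?p = "p_acc f gradf g l x y"
  obtain q where q: "q \<in> D" "\<And>z. z \<in> D \<Longrightarrow> subproblem x y q \<le> subproblem x y z"
    using strongly_convex_attains_min[OF subproblem_strongly_convex l_pos _ closed_sublevel_subproblem]
      assms by blast
  have min: "phi_acc f gradf g l x y q \<le> phi_acc f gradf g l x y z" for z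
    using q phi_acc_eq_subproblem phi_acc_outside_dom assms by (cases "z \<in> D") auto
  have p: "phi_acc f gradf g l x y ?p = ereal (subproblem x y q)"
    unfolding p_acc_def
    using arg_min_equality[of "\<lambda>_. True" q "phi_acc f gradf g l x y"] min
    by (simp add: phi_acc_eq_subproblem assms q)
  show dom: "?p \<in> D"
  proof (rule ccontr)
    assume "?p \<notin> D"
    then show False using p phi_acc_outside_dom[OF assms] by simp
  qed
  show "subproblem x y ?p \<le> subproblem x y z" if "z \<in> D"
    using p q that by (simp add: phi_acc_eq_subproblem assms dom)
qed

text \<open>
  Quadratic growth at the minimiser compares the subproblem at \<open>p\<close> and at \<open>z\<close>. At \<open>p\<close> the gradient
  Lipschitz bound turns the model plus the quadratic term into an upper bound for the objective;
  at \<open>z\<close> convexity bounds the model by the objective.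
\<close>

lemma p_acc_three_point:
  assumes x: "x \<in> D" and z: "z \<in> D" and p_def: "p = p_acc f gradf g l x y"
  shows "(MAX i. Fr i p - Fr i x) + l / 2 * (norm (z - p))\<^sup>2
    \<le> (MAX i. Fr i z - Fr i x) + l / 2 * (norm (z - y))\<^sup>2"
proof -
  have p: "p \<in> D" "\<And>z. z \<in> D \<Longrightarrow> subproblem x y p \<le> subproblem x y z"
    using p_acc_minimises x by (auto simp: p_def)
  have "Fr i p - Fr i x \<le> subproblem x y p" for i
  proof -
    have "model i y p - Fr i x \<le> (MAX i. model i y p - Fr i x)" by simp
    then show ?thesis using Fr_le_model[of i p y] unfolding subproblem_def by linarith
  qed
  then have max: "(MAX i. Fr i p - Fr i x) \<le> subproblem x y p" by simp
  have "subproblem x y p + l / 2 * (norm (z - p))\<^sup>2 \<le> subproblem x y z"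
    using strongly_convex_growth_at_min[OF subproblem_strongly_convex p z] .
  moreover have "model i y z - Fr i x \<le> (MAX i. Fr i z - Fr i x)" for i
  proof -
    have "Fr i z - Fr i x \<le> (MAX i. Fr i z - Fr i x)" by simp
    then show ?thesis using model_le_Fr[of i y z] by linarith
  qed
  then have "subproblem x y z \<le> (MAX i. Fr i z - Fr i x) + l / 2 * (norm (z - y))\<^sup>2"
    by (simp add: subproblem_def)
  ultimately show ?thesis using max by linarith
qed

text \<open>
  The case \<open>z = x\<close> of the three-point inequality, where the maximum on the right is \<open>0\<close>. Hence
  the bound holds in every component.
\<close>

lemma p_acc_descent:
  assumes "x \<in> D" and "p = p_acc f gradf g l x y"
  shows "Fr i p + l / 2 * (norm (x - p))\<^sup>2 \<le> Fr i x + l / 2 * (norm (x - y))\<^sup>2"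
proof -
  have "Fr i p - Fr i x \<le> (MAX i. Fr i p - Fr i x)" by simp
  moreover have "(MAX i. Fr i x - Fr i x) = 0" by simp
  ultimately show ?thesis using p_acc_three_point[OF assms(1,1,2)] by linarith
qed

text \<open>
  The supremum over \<open>z\<close> of this quantity is the merit function at \<open>x\<close>.
\<close>

definition gap where "gap x z = (MIN i. Fr i x - Fr i z)"

lemma gap_decrease:
  assumes "x \<in> D" and p_def: "p = p_acc f gradf g l x y"
  shows "l / 2 * ((norm (x - p))\<^sup>2 - (norm (x - y))\<^sup>2) \<le> gap x z - gap p z"
proof -
  have "gap p z + l / 2 * ((norm (x - p))\<^sup>2 - (norm (x - y))\<^sup>2) \<le> Fr i x - Fr i z" for i
  proof -
    have "gap p z \<le> Fr i p - Fr i z" by (simp add: gap_def)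
    then show ?thesis using p_acc_descent[OF assms, of i] by (simp add: algebra_simps)
  qed
  then have "gap p z + l / 2 * ((norm (x - p))\<^sup>2 - (norm (x - y))\<^sup>2) \<le> gap x z"
    unfolding gap_def by simp
  then show ?thesis by simp
qed

text \<open>
  The three-point inequality compares maxima only, so it controls \<open>Fr i p - Fr i z\<close> just in a
  component where \<open>Fr i z - Fr i x\<close> is largest. This is enough because the gap is a minimum.
\<close>

lemma gap_le:
  assumes "x \<in> D" and "z \<in> D" and "p = p_acc f gradf g l x y"
  shows "gap p z \<le> l / 2 * ((norm (z - y))\<^sup>2 - (norm (z - p))\<^sup>2)"
proof -
  have "(MAX i. Fr i z - Fr i x) \<in> range (\<lambda>i. Fr i z - Fr i x)" by (rule Max_in) auto
  then obtain j where j: "(MAX i. Fr i z - Fr i x) = Fr j z - Fr j x" by (rule imageE)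
  have "gap p z \<le> Fr j p - Fr j z" by (simp add: gap_def)
  moreover have "Fr j p - Fr j x \<le> (MAX i. Fr i p - Fr i x)" by simp
  ultimately show ?thesis
    using p_acc_three_point[OF assms] unfolding j by (simp add: algebra_simps)
qed

end

section \<open>The accelerated iteration\<close>

locale accelerated_run = composite_problem f gradf g l
  for f :: "'m::finite \<Rightarrow> 'a::euclidean_space \<Rightarrow> real" and gradf g l +
  fixes x y :: "nat \<Rightarrow> 'a" and t \<gamma> :: "nat \<Rightarrow> real"
  assumes generated: "accelerated_prox_grad f gradf g l x y t \<gamma>"
begin

lemma x_in_dom: "x k \<in> D"
proof (induction k)
  case 0
  then show ?case using generated unfolding accelerated_prox_grad_def by metis
next
  case (Suc k)
  have "x (Suc k) = p_acc f gradf g l (x k) (y (Suc k))"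
    using generated by (simp add: accelerated_prox_grad_def)
  then show ?case using p_acc_minimises(1)[OF Suc] by simp
qed

lemma x_Suc: "x (Suc k) = p_acc f gradf g l (x k) (y (Suc k))"
  using generated by (simp add: accelerated_prox_grad_def)

lemma y_1: "y (Suc 0) = x 0"
  using generated by (simp add: accelerated_prox_grad_def)

lemma t_1: "t (Suc 0) = 1"
  using generated by (simp add: accelerated_prox_grad_def)

lemma t_Suc: "t (Suc (Suc k)) = sqrt ((t (Suc k))\<^sup>2 + 1 / 4) + 1 / 2"
  using generated by (simp add: accelerated_prox_grad_def)

lemma y_Suc: "y (Suc (Suc k)) = x (Suc k) + ((t (Suc k) - 1) / t (Suc (Suc k))) *\<^sub>R (x (Suc k) - x k)"
  using generated by (simp add: accelerated_prox_grad_def)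

lemma t_lower: "t (Suc k) \<ge> (real k + 2) / 2"
proof (induction k)
  case 0
  then show ?case by (simp add: t_1)
next
  case (Suc k)
  have "t (Suc k) = sqrt ((t (Suc k))\<^sup>2)" using Suc by simp
  also have "\<dots> \<le> sqrt ((t (Suc k))\<^sup>2 + 1 / 4)" by (rule real_sqrt_le_mono) simp
  finally show ?case using Suc by (simp add: t_Suc)
qed

lemma t_recurrence: "t (Suc (Suc k)) * (t (Suc (Suc k)) - 1) = (t (Suc k))\<^sup>2"
proof -
  have "(sqrt ((t (Suc k))\<^sup>2 + 1 / 4))\<^sup>2 = (t (Suc k))\<^sup>2 + 1 / 4" by simp
  then show ?thesis unfolding t_Suc by (simp add: algebra_simps power2_eq_square)
qed

lemma extrapolation_le: "norm (x (Suc k) - y (Suc (Suc k))) \<le> norm (x (Suc k) - x k)"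
proof -
  have "0 \<le> t (Suc k) - 1" "t (Suc k) - 1 \<le> t (Suc (Suc k))" "0 < t (Suc (Suc k))"
  proof -
    show "0 \<le> t (Suc k) - 1" using t_lower[of k] by simp
    have "t (Suc k) = sqrt ((t (Suc k))\<^sup>2)" using t_lower[of k] by simp
    also have "\<dots> \<le> sqrt ((t (Suc k))\<^sup>2 + 1 / 4)" by (rule real_sqrt_le_mono) simp
    finally show "t (Suc k) - 1 \<le> t (Suc (Suc k))" by (simp add: t_Suc)
    show "0 < t (Suc (Suc k))" using t_lower[of "Suc k"] by simp
  qed
  moreover define c where "c = (t (Suc k) - 1) / t (Suc (Suc k))"
  ultimately have "0 \<le> c" "c \<le> 1" by auto
  then show ?thesis by (simp add: y_Suc mult_left_le_one_le flip: c_def)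
qed

text \<open>
  The objectives themselves need not be monotone along the iterates. What does not increase is
  the objective plus the energy of the last step, because the extrapolation is at most as
  long as that step.
\<close>

lemma energy_le_start: "Fr i (x (Suc k)) + l / 2 * (norm (x (Suc k) - x k))\<^sup>2 \<le> Fr i (x 0)"
proof (induction k)
  case 0
  show ?case using p_acc_descent[OF x_in_dom x_Suc, of i 0] by (simp add: y_1 norm_minus_commute)
next
  case (Suc k)
  have "Fr i (x (Suc (Suc k))) + l / 2 * (norm (x (Suc (Suc k)) - x (Suc k)))\<^sup>2
    \<le> Fr i (x (Suc k)) + l / 2 * (norm (x (Suc k) - y (Suc (Suc k))))\<^sup>2"
    using p_acc_descent[OF x_in_dom x_Suc, of i "Suc k"] by (simp add: norm_minus_commute)
  also have "\<dots> \<le> Fr i (x (Suc k)) + l / 2 * (norm (x (Suc k) - x k))\<^sup>2"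
    using extrapolation_le[of k] l_pos by (intro add_left_mono mult_left_mono power_mono) auto
  finally show ?case using Suc by simp
qed

lemma Fr_le_start: "Fr i (x k) \<le> Fr i (x 0)"
proof (cases k)
  case (Suc j)
  have "0 \<le> l / 2 * (norm (x (Suc j) - x j))\<^sup>2" using l_pos by simp
  then show ?thesis using energy_le_start[of i j] unfolding Suc by linarith
qed simp

lemma norm_affine_combination:
  fixes a b z :: "'c::real_inner"
  shows "(norm (s *\<^sub>R a - (s - 1) *\<^sub>R b - z))\<^sup>2
    = s * (norm (z - a))\<^sup>2 - (s - 1) * (norm (z - b))\<^sup>2 + s * (s - 1) * (norm (b - a))\<^sup>2"
  unfolding power2_norm_eq_inner
  by (simp add: inner_simps inner_commute algebra_simps power2_eq_square)

text \<open>
  The potential combines the weighted gap with the distance from \<open>z\<close> to an extrapolated point.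
  Its decrease is the sum of \<open>gap_decrease\<close> with weight \<open>t (t - 1)\<close> and \<open>gap_le\<close> with weight \<open>t\<close>:
  the weights add up to \<open>t\<^sup>2\<close>, the first equals the square of the previous \<open>t\<close>, and the
  choice of \<open>y\<close> makes the extrapolated points of consecutive steps match.
\<close>

lemma potential_le_start:
  assumes z: "z \<in> D"
  shows "(t (Suc k))\<^sup>2 * gap (x (Suc k)) z
      + l / 2 * (norm (t (Suc k) *\<^sub>R x (Suc k) - (t (Suc k) - 1) *\<^sub>R x k - z))\<^sup>2
    \<le> l / 2 * (norm (z - x 0))\<^sup>2"
proof (induction k)
  case 0
  show ?case using gap_le[OF x_in_dom z x_Suc, of 0]
    by (simp add: t_1 y_1 norm_minus_commute algebra_simps)
next
  case (Suc k)
  let ?p = "x (Suc (Suc k))" and ?x = "x (Suc k)" and ?y = "y (Suc (Suc k))"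
  let ?s = "t (Suc (Suc k))"
  have s: "?s \<ge> 1" using t_lower[of "Suc k"] by simp
  have "?s *\<^sub>R ?y = ?s *\<^sub>R ?x + (t (Suc k) - 1) *\<^sub>R (?x - x k)"
    using s by (simp add: y_Suc scaleR_add_right)
  then have match: "?s *\<^sub>R ?y - (?s - 1) *\<^sub>R ?x - z = t (Suc k) *\<^sub>R ?x - (t (Suc k) - 1) *\<^sub>R x k - z"
    by (simp add: algebra_simps)
  have "?s * (?s - 1) * (l / 2 * ((norm (?x - ?p))\<^sup>2 - (norm (?x - ?y))\<^sup>2))
    \<le> ?s * (?s - 1) * (gap ?x z - gap ?p z)"
    using gap_decrease[OF x_in_dom x_Suc] s by (intro mult_left_mono) auto
  moreover have "?s * gap ?p z \<le> ?s * (l / 2 * ((norm (z - ?y))\<^sup>2 - (norm (z - ?p))\<^sup>2))"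
    using gap_le[OF x_in_dom z x_Suc] s by (intro mult_left_mono) auto
  ultimately have "?s\<^sup>2 * gap ?p z + l / 2 * (norm (?s *\<^sub>R ?p - (?s - 1) *\<^sub>R ?x - z))\<^sup>2
    \<le> ?s * (?s - 1) * gap ?x z + l / 2 * (norm (?s *\<^sub>R ?y - (?s - 1) *\<^sub>R ?x - z))\<^sup>2"
    unfolding norm_affine_combination by (simp add: field_simps power2_eq_square)
  then show ?case using Suc unfolding t_recurrence match by linarith
qed

lemma gap_rate:
  assumes "z \<in> D" and "k \<ge> 1"
  shows "gap (x k) z \<le> 2 * l / (real k + 1)\<^sup>2 * (norm (z - x 0))\<^sup>2"
proof -
  obtain j where k: "k = Suc j" using assms(2) by (cases k) auto
  have t: "t k \<ge> (real k + 1) / 2" "t k > 0" using t_lower[of j] by (auto simp: k)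
  have "0 \<le> l / 2 * (norm (t k *\<^sub>R x k - (t k - 1) *\<^sub>R x j - z))\<^sup>2"
    using l_pos by simp
  then have "(t k)\<^sup>2 * gap (x k) z \<le> l / 2 * (norm (z - x 0))\<^sup>2"
    using potential_le_start[OF assms(1), of j] unfolding k by linarith
  then have "gap (x k) z \<le> l / 2 * (norm (z - x 0))\<^sup>2 / (t k)\<^sup>2"
    using t(2) by (subst pos_le_divide_eq) (auto simp: mult.commute)
  also have "\<dots> \<le> l / 2 * (norm (z - x 0))\<^sup>2 / ((real k + 1) / 2)\<^sup>2"
    using t l_pos by (intro divide_left_mono power_mono) auto
  also have "\<dots> = 2 * l / (real k + 1)\<^sup>2 * (norm (z - x 0))\<^sup>2"
    by (simp add: power_divide)
  finally show ?thesis .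
qed

end

section \<open>The rate for the merit function\<close>

context accelerated_run
begin

text \<open>
  The rate for the gap involves the distance from the start to \<open>z\<close>, which need not be bounded.
  A point \<open>z\<close> with positive gap has \<open>F z \<le> F (x k) \<le> F (x 0)\<close>, hence it is dominated by a
  weakly Pareto optimal point of the level set. Passing to that point does not decrease
  the gap, and neither does moving it within its fibre, to points almost as close to \<open>x 0\<close> as
  the fibre allows.
\<close>

lemma merit_le_of_sup_inf_sq_dist:
  assumes dominated: "\<And>z. z \<in> level_set (composite_obj f g) (composite_obj f g (x 0)) \<Longrightarrow>
      \<exists>xs \<in> weakly_pareto_set (composite_obj f g). composite_obj f g xs \<le> composite_obj f g z"
    and finite: "sup_inf_sq_dist (composite_obj f g) (x 0) < \<infinity>"
    and "k \<ge> 1"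
  shows "merit (composite_obj f g) (x k)
    \<le> ereal (2 * l) * sup_inf_sq_dist (composite_obj f g) (x 0) / ereal ((real k + 1)\<^sup>2)"
proof -
  let ?F = "composite_obj f g"
  let ?E = "weakly_pareto_set ?F \<inter> level_set ?F (?F (x 0))"
  let ?R = "sup_inf_sq_dist ?F (x 0)"
  let ?I = "\<lambda>Fs. INF w \<in> ?F -` {Fs}. ereal ((norm (w - x 0))\<^sup>2)"
  have R_upper: "?I (?F xs) \<le> ?R" if "xs \<in> ?E" for xs
    unfolding sup_inf_sq_dist_def using that by (intro SUP_upper) blast
  have below_start: "\<exists>xs \<in> ?E. ?F xs \<le> ?F z" if "?F z \<le> ?F (x 0)" for z
    using dominated[of z] that order_trans by (fastforce simp: level_set_def)
  \<comment> \<open>The domination hypothesis at \<open>x 0\<close> makes the supremum range over a nonempty set.\<close>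
  obtain xs0 where "xs0 \<in> ?E" using below_start[of "x 0"] by blast
  then have "0 \<le> ?R"
    using R_upper by (meson INF_greatest ereal_less_eq(5) order_trans zero_le_power2)
  then obtain r where r: "?R = ereal r" "0 \<le> r" using finite by (cases ?R) auto
  define B where "B = 2 * l / (real k + 1)\<^sup>2"
  have B: "B > 0" using l_pos by (simp add: B_def add_pos_nonneg)
  have "(MIN i. ?F (x k) i - ?F z i) \<le> ereal (B * r)" for z
  proof (rule ccontr)
    assume "\<not> ?thesis"
    then have gt: "?F (x k) i - ?F z i > ereal (B * r)" for i
      by (simp add: not_le Min_gr_iff)
    have "0 \<le> B * r" using B r by simp
    have lt: "g i z < \<infinity> \<and> ereal (Fr i (x k)) - ?F z i > 0" for i
    proof -
      have "ereal (Fr i (x k)) - ?F z i > ereal (B * r)"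
        using gt[of i] by (simp add: composite_obj_eq x_in_dom)
      then show ?thesis using \<open>0 \<le> B * r\<close>
        by (cases "g i z") (auto simp: composite_obj_def zero_ereal_def)
    qed
    then have z: "z \<in> D" by (simp add: mem_dom_iff)
    have "Fr i z \<le> Fr i (x 0)" for i
      using lt[of i] Fr_le_start[of i k] by (simp add: composite_obj_eq z)
    then have "?F z \<le> ?F (x 0)" by (simp add: le_fun_def composite_obj_eq z x_in_dom)
    then obtain xs where xs: "xs \<in> ?E" "?F xs \<le> ?F z" using below_start by blast
    have "?F xs i \<le> ?F z i" for i using xs(2) by (simp add: le_fun_def)
    moreover have "?F z i < \<infinity>" for i using z by (simp add: effective_dom_def)
    ultimately have xs_dom: "xs \<in> D" using le_less_trans by (fastforce simp: effective_dom_def)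
    define s where "s = gap (x k) xs"
    have "B * r < Fr i (x k) - Fr i xs" for i
      using gt[of i] xs(2) by (auto simp: le_fun_def composite_obj_eq z x_in_dom xs_dom
        intro: less_le_trans dest!: spec[of _ i])
    then have "B * r < s" by (simp add: s_def gap_def)
    \<comment> \<open>The gap depends on its second argument only through the objective values, so the rate
      holds with the distance of every point of the fibre over \<open>?F xs\<close>.\<close>
    have "ereal (s / B) \<le> ereal ((norm (w - x 0))\<^sup>2)" if w: "w \<in> ?F -` {?F xs}" for w
    proof -
      have w_dom: "w \<in> D" using w xs_dom by (simp add: effective_dom_def)
      have "ereal (Fr i w) = ereal (Fr i xs)" for i
        using w by (simp add: w_dom xs_dom flip: composite_obj_eq)
      then have "s = gap (x k) w" by (simp add: s_def gap_def)
      then have "s \<le> B * (norm (w - x 0))\<^sup>2" using gap_rate[OF w_dom assms(3)] by (simp add: B_def)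
      then show ?thesis using B by (simp add: pos_divide_le_eq mult.commute)
    qed
    then have "ereal (s / B) \<le> ?I (?F xs)" by (rule INF_greatest)
    also have "\<dots> \<le> ereal r" using R_upper[OF xs(1)] r by simp
    finally show False using B \<open>B * r < s\<close> by (simp add: pos_divide_le_eq mult.commute)
  qed
  then have "merit ?F (x k) \<le> ereal (B * r)" unfolding merit_def by (intro SUP_least)
  then show ?thesis by (simp add: r B_def)
qed

end

theorem theorem5p2:
  fixes f :: "'m::finite \<Rightarrow> real ^ 'n \<Rightarrow> real"
    and gradf :: "'m \<Rightarrow> real ^ 'n \<Rightarrow> real ^ 'n"
    and g :: "'m \<Rightarrow> real ^ 'n \<Rightarrow> ereal"
    and F :: "real ^ 'n \<Rightarrow> 'm \<Rightarrow> ereal"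
    and L :: "'m \<Rightarrow> real"
    and l :: real
    and x y :: "nat \<Rightarrow> real ^ 'n"
    and t \<gamma> :: "nat \<Rightarrow> real"
    and R :: ereal
  assumes f_convex: "\<And>i. convex_on UNIV (f i)"
    and f_gradient: "\<And>i x. GDERIV (f i) x :> gradf i x"
    and gradf_continuous: "\<And>i. continuous_on UNIV (gradf i)"
    and L_pos: "\<And>i. L i > 0"
    and gradf_lipschitz: "\<And>i. (L i)-lipschitz_on UNIV (gradf i)"
    and g_closed: "\<And>i. closed_fun (g i)"
    and g_proper: "\<And>i. proper_fun (g i)"
    and g_convex: "\<And>i. convex_fun (g i)"
    and F_eq: "F = composite_obj f g"
    and l_ge: "l \<ge> (MAX i. L i)"
    and generated: "accelerated_prox_grad f gradf g l x y t \<gamma>"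
    and pareto_dominated:
      "\<forall>z \<in> level_set F (F (x 0)). \<exists>xs \<in> weakly_pareto_set F. F xs \<le> F z"
    and R_eq: "R = sup_inf_sq_dist F (x 0)"
    and R_finite: "R < \<infinity>"
  shows "\<forall>k\<ge>1. merit F (x k) \<le> ereal (2 * l) * R / ereal ((real k + 1)\<^sup>2)"
proof -
  have L_le: "L i \<le> l" for i using l_ge by simp
  interpret accelerated_run f gradf g l x y t \<gamma>
  proof
    show "l > 0" using L_pos L_le less_le_trans by blast
    show "l-lipschitz_on UNIV (gradf i)" for i
      using gradf_lipschitz L_le by (rule lipschitz_on_le)
  qed (fact assms)+
  show ?thesis
    using merit_le_of_sup_inf_sq_dist pareto_dominated R_finite unfolding R_eq F_eq by blast
qed

end
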